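(* Let $p$ be a prime number and $m$ a positive integer. If $A$ is a spectral set in $\mathbb Z_{p^m}\times\mathbb Z_{p^m}$ with $p^{2m}>|A|\ge p^{2m-1}$, then $A$ is a tile in $\mathbb Z_{p^m}\times\mathbb Z_{p^m}$ and $|A|=p^{2m-1}$.
   Context: $\mathbb Z_n$ denotes the additive cyclic group of order $n$. A subset $A$ of a finite abelian group $G$ is a tile in $G$ if there is $B\subseteq G$ such that every element of $G$ can be written in exactly one way as $a+b$ with $a\in A$, $b\in B$. For $x=(x_1,x_2)$, $s=(s_1,s_2)$ in $\mathbb Z_n\times\mathbb Z_n$ put $\langle x,s\rangle=x_1s_1+x_2s_2$ (mod $n$). A subset $A\subseteq\mathbb Z_n\times\mathbb Z_n$ is spectral if there is $S\subseteq\mathbb Z_n\times\mathbb Z_n$ such that the family of functions $x\mapsto e^{2\pi i\langle x,s\rangle/n}$ on $A$, indexed by $s\in S$, is an orthogonal basis of $L^2(A)$ with respect to the counting measure on $A$. *)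

theory Defs
  imports "HOL-Algebra.Elementary_Groups" "HOL-Computational_Algebra.Primes"
    "HOL-Library.Function_Algebras" Complex_Main
begin

abbreviation Z2 :: "nat \<Rightarrow> (int \<times> int) monoid"
  where "Z2 n \<equiv> integer_mod_group n \<times>\<times> integer_mod_group n"

(* Groups are written multiplicatively in HOL-Algebra: the operation is the a + b of an additive group. *)
definition tile :: "('a, 'm) monoid_scheme \<Rightarrow> 'a set \<Rightarrow> bool"
  where "tile G A \<longleftrightarrow> A \<subseteq> carrier G \<and>
    (\<exists>B \<subseteq> carrier G. \<forall>g \<in> carrier G. \<exists>!ab. ab \<in> A \<times> B \<and> g = fst ab \<otimes>\<^bsub>G\<^esub> snd ab)"

definition pairing :: "nat \<Rightarrow> int \<times> int \<Rightarrow> int \<times> int \<Rightarrow> int"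
  where "pairing n x s = (fst x * fst s + snd x * snd s) mod int n"

(* L^2(A) for the counting measure on a finite set A: functions on A, represented by their
   extension by 0, so that it is a subspace of the complex vector space of all functions. *)
definition L2 :: "'a set \<Rightarrow> ('a \<Rightarrow> complex) set"
  where "L2 A = {f. \<forall>x. x \<notin> A \<longrightarrow> f x = 0}"

definition inner_L2 :: "'a set \<Rightarrow> ('a \<Rightarrow> complex) \<Rightarrow> ('a \<Rightarrow> complex) \<Rightarrow> complex"
  where "inner_L2 A f g = (\<Sum>x\<in>A. f x * cnj (g x))"

definition scale_fun :: "complex \<Rightarrow> ('a \<Rightarrow> complex) \<Rightarrow> 'a \<Rightarrow> complex"
  where "scale_fun c f = (\<lambda>x. c * f x)"

(* Sanity check: the vector space in which span and dependence are taken below. *)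
lemma vector_space_scale_fun: "vector_space scale_fun"
  by unfold_locales (auto simp: scale_fun_def fun_eq_iff algebra_simps)

(* A basis given as an indexed family: a repeated member makes it linearly dependent,
   hence the injectivity. For finite A no completion of the algebraic span is needed. *)
definition orthogonal_basis_L2 :: "'a set \<Rightarrow> 'i set \<Rightarrow> ('i \<Rightarrow> 'a \<Rightarrow> complex) \<Rightarrow> bool"
  where "orthogonal_basis_L2 A S e \<longleftrightarrow>
    (\<forall>s\<in>S. \<forall>t\<in>S. s \<noteq> t \<longrightarrow> inner_L2 A (e s) (e t) = 0) \<and>
    inj_on e S \<and> \<not> module.dependent scale_fun (e ` S) \<and> module.span scale_fun (e ` S) = L2 A"

definition character_on :: "nat \<Rightarrow> (int \<times> int) set \<Rightarrow> int \<times> int \<Rightarrow> int \<times> int \<Rightarrow> complex"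
  where "character_on n A s = (\<lambda>x. if x \<in> A
    then exp (2 * complex_of_real pi * \<i> * of_int (pairing n x s) / of_nat n) else 0)"

definition spectral :: "nat \<Rightarrow> (int \<times> int) set \<Rightarrow> bool"
  where "spectral n A \<longleftrightarrow> A \<subseteq> carrier (Z2 n) \<and>
    (\<exists>S \<subseteq> carrier (Z2 n). orthogonal_basis_L2 A S (character_on n A))"

end

theory Submission
  imports Defs "HOL-Computational_Algebra.Polynomial_Factorial"
    "HOL-Computational_Algebra.Fundamental_Theorem_Algebra"
    "HOL-Library.Product_Plus" "HOL-Number_Theory.Cong"
begin

text \<open>
  Let \<open>S\<close> be a spectrum of \<open>A\<close> and write \<open>F g\<close> for the sum of \<open>exp (2 \<pi> i \<langle>g, s\<rangle> / n)\<close> over \<open>s \<in> S\<close>,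
  with \<open>n = p ^ m\<close>. The square character matrix has orthogonal rows, hence orthogonal columns: \<open>F\<close>
  vanishes at every nonzero difference of two elements of \<open>A\<close>. As \<open>S\<close> is neither empty nor the
  whole group, \<open>F g \<noteq> 0\<close> for some \<open>g \<noteq> 0\<close>. Conjugation over the rationals gives \<open>F (u g) \<noteq> 0\<close> for all
  \<open>u\<close> prime to \<open>p\<close>, so no \<open>u g\<close> is a difference in \<open>A\<close>. Therefore the translates of \<open>A\<close> by
  \<open>0, g, \<dots>, (p - 1) g\<close> are disjoint, and as \<open>p * card A \<ge> p ^ (2 * m)\<close> they fill the group.
\<close>

section \<open>Evaluation of integer polynomials and minimal polynomials over the integers\<close>

abbreviation ipoly :: "int poly \<Rightarrow> 'a::comm_ring_1 \<Rightarrow> 'a"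
  where "ipoly P z \<equiv> poly (map_poly of_int P) z"

lemma ipoly_add: "ipoly (P + Q) z = ipoly P z + ipoly Q z"
  by (induction P Q rule: poly_induct2) (simp_all add: map_poly_pCons algebra_simps)

lemma ipoly_smult: "ipoly (smult c P) z = of_int c * ipoly P z"
  by (induction P) (simp_all add: map_poly_pCons algebra_simps)

lemma ipoly_mult: "ipoly (P * Q) z = ipoly P z * ipoly Q z"
  by (induction P) (simp_all add: map_poly_pCons ipoly_add ipoly_smult algebra_simps)

lemma ipoly_monom: "ipoly (monom c k) z = of_int c * z ^ k"
  by (simp add: map_poly_monom poly_monom)

lemma ipoly_sum: "ipoly (\<Sum>i\<in>I. P i) z = (\<Sum>i\<in>I. ipoly (P i) z)"
  by (induction I rule: infinite_finite_induct) (simp_all add: ipoly_add)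

lemma ipoly_pcompose: "ipoly (pcompose P Q) z = ipoly P (ipoly Q z)"
  by (induction P) (simp_all add: map_poly_pCons ipoly_add ipoly_mult pcompose_pCons)

text \<open>By Gauss, content is multiplicative, so \<open>a\<close> divides the content of the
  cofactor of \<open>f\<close> and can be cancelled on both sides.\<close>

lemma primitive_dvd_cancel_smult:
  fixes f P :: "int poly"
  assumes "content f = 1" "a \<noteq> 0" "f dvd smult a P"
  shows "f dvd P"
proof -
  from assms(3) obtain q where q: "smult a P = f * q" by (elim dvdE)
  have "content (smult a P) = content q"
    using assms(1) by (simp add: q content_mult)
  then have "a dvd content q"
    by (metis content_smult dvd_triv_left normalize_dvd_iff normalize_mult)
  then obtain r where "q = [:a:] * r" by (metis const_poly_dvd_iff_dvd_content dvdE)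
  then have "smult a P = smult a (f * r)" using q by simp
  then have "[:a:] * P = [:a:] * (f * r)" by simp
  then have "P = f * r" using assms(2) mult_left_cancel[of "[:a:]"] by simp
  then show ?thesis by simp
qed

text \<open>\<open>f\<close> is the primitive part of a nonzero polynomial of least degree vanishing
  at \<open>z\<close>. Pseudo-division by \<open>f\<close> keeps integer coefficients; its remainder
  vanishes at \<open>z\<close>, hence is 0 by minimality, and primitivity of \<open>f\<close>
  removes the factor that multiplies \<open>P\<close>.\<close>

lemma int_minimal_poly:
  fixes z :: complex
  assumes "P0 \<noteq> 0" "ipoly P0 z = 0"
  obtains f where "f \<noteq> 0" "ipoly f z = 0" "\<And>P. ipoly P z = 0 \<Longrightarrow> f dvd P"
proof -
  let ?I = "{P. P \<noteq> 0 \<and> ipoly P z = 0}"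
  from ex_has_least_nat[of "\<lambda>P. P \<in> ?I" P0 degree] assms
  obtain h where h: "h \<in> ?I" "\<And>P. P \<in> ?I \<Longrightarrow> degree h \<le> degree P" by auto
  define f where "f = primitive_part h"
  have hf: "h = smult (content h) f" by (simp add: f_def)
  have "content h \<noteq> 0" using h(1) by simp
  have f: "f \<noteq> 0" "content f = 1" "degree f = degree h" using h(1) by (auto simp: f_def)
  have fz: "ipoly f z = 0"
    using h(1) \<open>content h \<noteq> 0\<close> hf ipoly_smult[of "content h" f z] by simp
  have "f dvd P" if P: "ipoly P z = 0" for P
  proof -
    define r where "r = pseudo_mod P f"
    from pseudo_mod[OF f(1), of P] obtain a q
      where a: "a \<noteq> 0" "smult a P = f * q + r" and r: "r = 0 \<or> degree r < degree f"
      unfolding r_def by blast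
    have "ipoly (smult a P) z = ipoly (f * q + r) z" by (simp add: a)
    then have "ipoly r z = 0" by (simp add: ipoly_smult ipoly_add ipoly_mult P fz)
    then have "r = 0" using r h(2)[of r] f(3) by force
    then show ?thesis using primitive_dvd_cancel_smult[OF f(2) a(1)] a(2) by simp
  qed
  with f(1) fz show thesis by (rule that)
qed

section \<open>Primitive roots of unity of order \<open>p ^ Suc k\<close> and their
  conjugacy\<close>

definition prime_power_primitive_roots :: "nat \<Rightarrow> nat \<Rightarrow> complex set"
  where "prime_power_primitive_roots p k = {z. z ^ (p ^ Suc k) = 1 \<and> z ^ (p ^ k) \<noteq> 1}"

text \<open>For prime \<open>p\<close> this is the cyclotomic polynomial of order
  \<open>p ^ Suc k\<close>, the quotient of \<open>X ^ (p ^ Suc k) - 1\<close> by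
  \<open>X ^ (p ^ k) - 1\<close>.\<close>

definition prime_power_cyclotomic :: "nat \<Rightarrow> nat \<Rightarrow> int poly"
  where "prime_power_cyclotomic p k = (\<Sum>i<p. monom 1 (p ^ k * i))"

lemma ipoly_prime_power_cyclotomic: "ipoly (prime_power_cyclotomic p k) z = (\<Sum>i<p. (z ^ p ^ k) ^ i)"
  by (simp add: prime_power_cyclotomic_def ipoly_sum ipoly_monom power_mult)

lemma poly_prime_power_cyclotomic_1: "poly (prime_power_cyclotomic p k) 1 = int p"
  by (simp add: prime_power_cyclotomic_def poly_sum poly_monom)

lemma poly_prime_power_cyclotomic_0: "p > 0 \<Longrightarrow> poly (prime_power_cyclotomic p k) 0 = 1"
  by (simp add: prime_power_cyclotomic_def poly_sum poly_monom power_0_left sum.delta)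

lemma prime_power_cyclotomic_root_iff:
  assumes "p > 0"
  shows "ipoly (prime_power_cyclotomic p k) z = 0 \<longleftrightarrow> z \<in> prime_power_primitive_roots p k"
proof (cases "z ^ p ^ k = 1")
  case True
  then show ?thesis using assms by (simp add: ipoly_prime_power_cyclotomic prime_power_primitive_roots_def)
next
  case False
  then show ?thesis
    by (simp add: ipoly_prime_power_cyclotomic prime_power_primitive_roots_def geometric_sum)
      (simp add: mult.commute flip: power_mult)
qed

text \<open>Both roots are powers of \<open>cis (2 * pi / p ^ Suc k)\<close>. The exponent of
  \<open>z\<close> is prime to \<open>p\<close>, hence invertible modulo \<open>p ^ Suc k\<close>,
  so \<open>z\<close> is a generator as well.\<close>

lemma prime_power_primitive_roots_powers:
  assumes p: "prime p" and z: "z \<in> prime_power_primitive_roots p k"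
    and w: "w \<in> prime_power_primitive_roots p k"
  obtains v where "w = z ^ v"
proof -
  let ?n = "p ^ Suc k"
  have n: "?n > 0" using p by (simp add: prime_gt_0_nat)
  define e where "e = (\<lambda>j. cis (2 * pi * real j / real ?n))"
  have ee: "e j = e 1 ^ j" for j
    by (simp add: e_def DeMoivre field_simps)
  have e1: "e 1 ^ ?n = 1" using n unfolding ee[symmetric] by (simp add: e_def)
  have "z \<in> e ` {..<?n}" "w \<in> e ` {..<?n}"
    using z w bij_betw_imp_surj_on[OF bij_betw_roots_unity[OF n]]
    by (auto simp: prime_power_primitive_roots_def e_def)
  then obtain a b where ab: "z = e 1 ^ a" "w = e 1 ^ b" by (metis ee imageE)
  have "\<not> p dvd a"
  proof
    assume "p dvd a"
    then obtain c where "a = p * c" by (elim dvdE)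
    then have "z ^ p ^ k = (e 1 ^ ?n) ^ c"
      by (simp only: ab(1) flip: power_mult) (simp add: ac_simps)
    then show False using z e1 by (simp add: prime_power_primitive_roots_def)
  qed
  then have "coprime a ?n"
    using p by (metis coprime_commute coprime_power_right_iff prime_imp_coprime_nat)
  then obtain a' where "[a * a' = 1] (mod ?n)"
    using cong_solve_coprime_nat[of a ?n] by (auto simp del: power_Suc)
  then have "[a * (a' * b) = b] (mod ?n)"
    by (metis cong_scalar_right mult.assoc mult_1)
  moreover have "e 1 ^ x = e 1 ^ y" if "[x = y] (mod ?n)" for x y
  proof -
    have "e 1 ^ t = e 1 ^ (t mod ?n)" for t
      by (metis div_mult_mod_eq e1 mult.commute mult_1 power_add power_mult power_one)
    then show ?thesis using that by (metis unique_euclidean_semiring_class.cong_def)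
  qed
  ultimately have "w = z ^ (a' * b)"
    by (metis ab power_mult)
  then show thesis by (rule that)
qed

text \<open>
  Irreducibility of the cyclotomic polynomial \<open>\<Phi>\<close>, read off at \<open>1\<close>. The minimal polynomials of the
  primitive roots all have the same value \<open>d\<close> at \<open>1\<close> up to sign, because the roots are powers of
  each other. Two different ones would give \<open>d\<^sup>2 dvd \<Phi>(1) = p\<close>, so \<open>d\<close> would be a unit and, by
  factoring, \<open>\<Phi>(1)\<close> too.
\<close>
lemma conjugate_prime_power_roots:
  assumes p: "prime p" and z: "z \<in> prime_power_primitive_roots p k"
    and w: "w \<in> prime_power_primitive_roots p k"
    and P: "ipoly P z = 0"
  shows "ipoly P w = 0"
proof -
  let ?R = "prime_power_primitive_roots p k" and ?\<Phi> = "prime_power_cyclotomic p k"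
  have p0: "p > 0" using p by (simp add: prime_gt_0_nat)
  have \<Phi>0: "?\<Phi> \<noteq> 0" using poly_prime_power_cyclotomic_0[OF p0, of k] by auto
  have root: "ipoly ?\<Phi> x = 0 \<longleftrightarrow> x \<in> ?R" for x using p0 by (rule prime_power_cyclotomic_root_iff)
  have "\<exists>f. f \<noteq> 0 \<and> ipoly f x = 0 \<and> (\<forall>P. ipoly P x = 0 \<longrightarrow> f dvd P)" if "x \<in> ?R" for x
    using int_minimal_poly[OF \<Phi>0] root that by metis
  then obtain h where h0: "\<And>x. x \<in> ?R \<Longrightarrow> h x \<noteq> 0"
    and hx: "\<And>x. x \<in> ?R \<Longrightarrow> ipoly (h x) x = 0"
    and hdvd: "\<And>x P. x \<in> ?R \<Longrightarrow> ipoly P x = 0 \<Longrightarrow> h x dvd P"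
    by metis
  \<comment> \<open>If \<open>y = x ^ v\<close>, then \<open>h y\<close> composed with
    \<open>X ^ v\<close> vanishes at \<open>x\<close>, so \<open>h x\<close> divides it. The
    substitution fixes 1, so evaluation there compares the two values.\<close>
  have h1: "poly (h x) 1 dvd poly (h y) 1" if x: "x \<in> ?R" and y: "y \<in> ?R" for x y
  proof -
    obtain v where v: "y = x ^ v" using prime_power_primitive_roots_powers[OF p x y] .
    have "ipoly (pcompose (h y) (monom 1 v)) x = 0"
      using hx[OF y] by (simp add: ipoly_pcompose ipoly_monom v)
    then have "h x dvd pcompose (h y) (monom 1 v)" using hdvd x by blast
    then have "poly (h x) 1 dvd poly (pcompose (h y) (monom 1 v)) 1" 
      by (metis dvd_def poly_mult)
    then show ?thesis by (simp add: poly_pcompose poly_monom)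
  qed
  have hdeg: "degree (h x) > 0" if "x \<in> ?R" for x
  proof (rule ccontr)
    assume "\<not> ?thesis"
    then obtain c where "h x = [:c:]" by (metis degree_eq_zeroE gr0I)
    then show False using h0[OF that] hx[OF that] by (simp add: map_poly_pCons)
  qed
  \<comment> \<open>Induction on the degree: a complex root of \<open>D\<close> is a root of
    \<open>?\<Phi>\<close>, so its minimal polynomial splits off and leaves a divisor of smaller
    degree.\<close>
  have unit_factor: "is_unit (poly D 1)"
    if "\<And>x. x \<in> ?R \<Longrightarrow> is_unit (poly (h x) 1)" "D dvd ?\<Phi>" for D
    using that(2)
  proof (induction "degree D" arbitrary: D rule: less_induct)
    case less
    from less.prems obtain E where E: "?\<Phi> = D * E" by (elim dvdE)
    show ?case
    proof (cases "degree D = 0")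
      case True
      then obtain c where c: "D = [:c:]" by (elim degree_eq_zeroE)
      \<comment> \<open>The constant term 1 of \<open>?\<Phi>\<close> forces a constant divisor to
        be a unit.\<close>
      then have "c * poly E 0 = 1" using poly_prime_power_cyclotomic_0[OF p0, of k] E by simp
      then show ?thesis using c by (metis dvd_triv_left poly_const_conv)
    next
      case False
      have "degree (map_poly of_int D :: complex poly) = degree D"
        by (simp add: degree_map_poly)
      then obtain x :: complex where x: "ipoly D x = 0"
        using False fundamental_theorem_of_algebra constant_degree by metis
      then have "ipoly ?\<Phi> x = 0" by (simp add: E ipoly_mult)
      then have xR: "x \<in> ?R" by (simp add: root)
      obtain D' where D': "D = h x * D'" using hdvd[OF xR x] by (elim dvdE)
      have "D' \<noteq> 0" using D' False by auto
      then have "degree D' < degree D"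
        using D' hdeg[OF xR] h0[OF xR] by (simp add: degree_mult_eq)
      moreover have "D' dvd ?\<Phi>" using less.prems D' by (metis dvd_mult_right)
      ultimately have "is_unit (poly D' 1)" by (rule less.hyps)
      then show ?thesis using that(1)[OF xR] D' by (simp add: abs_mult)
    qed
  qed
  have hw: "ipoly (h z) w = 0"
  proof (rule ccontr)
    assume nz: "ipoly (h z) w \<noteq> 0"
    obtain g where g: "?\<Phi> = h z * g" using hdvd[OF z] root z by (metis dvdE)
    have "ipoly g w = 0" using nz root[of w] w by (simp add: g ipoly_mult)
    then have "h w dvd g" using hdvd[OF w] by blast
    then have "poly (h z) 1 * poly (h w) 1 dvd int p"
      using g poly_prime_power_cyclotomic_1[of p k] by (metis dvd_def mult.assoc poly_mult)
    then have sq: "poly (h z) 1 * poly (h z) 1 dvd int p"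
      using h1[OF z w] by (meson dvd_trans mult_dvd_mono dvd_refl)
    have "is_unit (poly (h z) 1)"
    proof -
      \<comment> \<open>With \<open>d = poly (h z) 1\<close>, irreducibility of
        \<open>p = d * (d * c)\<close> makes \<open>d\<close> or \<open>d * c\<close> a unit; either
        way \<open>d\<close> is one.\<close>
      obtain c where c: "int p = poly (h z) 1 * (poly (h z) 1 * c)" using sq by (metis dvdE mult.assoc)
      have "irreducible (int p)" using p by (simp add: prime_elem_imp_irreducible)
      from irreducibleD[OF this c] show ?thesis using dvd_mult_left by blast
    qed
    then have "is_unit (poly (h x) 1)" if "x \<in> ?R" for x using h1[OF that z] by (meson dvd_trans)
    then have "is_unit (poly ?\<Phi> 1)" using unit_factor[OF _ dvd_refl] by blast
    then show False using p by (simp add: poly_prime_power_cyclotomic_1)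
  qed
  obtain q where "P = h z * q" using hdvd[OF z P] by (elim dvdE)
  then show ?thesis using hw by (simp add: ipoly_mult)
qed

section \<open>Roots of unity as functions of an integer exponent\<close>

definition root_exp :: "nat \<Rightarrow> int \<Rightarrow> complex"
  where "root_exp n k = cis (2 * pi * of_int k / of_nat n)"

lemma root_exp_0 [simp]: "root_exp n 0 = 1"
  by (simp add: root_exp_def)

lemma root_exp_add: "root_exp n (j + k) = root_exp n j * root_exp n k"
  by (simp add: root_exp_def cis_mult add_divide_distrib ring_distribs)

lemma root_exp_mult_nat: "root_exp n (k * int j) = root_exp n k ^ j"
  by (induction j) (simp_all add: ring_distribs root_exp_add)

lemma root_exp_uminus: "root_exp n (- k) = cnj (root_exp n k)"
  by (simp add: root_exp_def cis_cnj)

lemma root_exp_eq_1_iff: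
  assumes "n > 0"
  shows "root_exp n k = 1 \<longleftrightarrow> int n dvd k"
proof -
  have "root_exp n k = 1 \<longleftrightarrow> (\<exists>j::int. 2 * pi * of_int k / of_nat n = 2 * pi * of_int j)"
  proof
    assume "root_exp n k = 1"
    then have "cos (2 * pi * of_int k / of_nat n) = 1" by (simp add: root_exp_def complex_eq_iff)
    then show "\<exists>j::int. 2 * pi * of_int k / of_nat n = 2 * pi * of_int j"
      unfolding cos_one_2pi_int by (metis mult.commute mult.assoc)
  next
    assume "\<exists>j::int. 2 * pi * of_int k / of_nat n = 2 * pi * of_int j"
    then show "root_exp n k = 1"
      unfolding root_exp_def by (elim exE, simp only:) (rule cis_multiple_2pi, simp)
  qed
  also have "\<dots> \<longleftrightarrow> (\<exists>j::int. k = int n * j)"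
  proof -
    have "2 * pi * of_int k / of_nat n = 2 * pi * of_int j \<longleftrightarrow> real_of_int k = real_of_int (int n * j)" for j
      using assms by (simp add: field_simps)
    then show ?thesis by (simp only: of_int_eq_iff)
  qed
  finally show ?thesis by (simp add: dvd_def)
qed

lemma root_exp_cong:
  assumes "n > 0" "[j = k] (mod int n)"
  shows "root_exp n j = root_exp n k"
proof -
  from assms(2) have "root_exp n (j - k) = 1"
    using assms(1) by (simp add: root_exp_eq_1_iff cong_iff_dvd_diff)
  then show ?thesis using root_exp_add[of n "j - k" k] by simp
qed

lemma root_exp_primitive:
  assumes "prime p" "coprime u (int p)"
  shows "root_exp (p ^ Suc k) u \<in> prime_power_primitive_roots p k"
proof -
  have p0: "p > 0" and p1: "\<not> is_unit (int p)" using assms(1) by (auto simp: prime_gt_0_nat)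
  have "\<not> int (p ^ Suc k) dvd u * int (p ^ k)"
    using p0 p1 assms(2) coprime_common_divisor[OF assms(2), of "int p"] by auto
  moreover have "root_exp (p ^ Suc k) (u * int (p ^ Suc k)) = 1"
    using p0 by (subst root_exp_eq_1_iff) auto
  ultimately show ?thesis
    using p0 unfolding prime_power_primitive_roots_def
    by (simp add: root_exp_eq_1_iff flip: root_exp_mult_nat del: of_nat_power power_Suc)
qed

text \<open>With exponents reduced modulo \<open>p ^ m\<close>, the two sums are the values of one
  integer polynomial at \<open>root_exp (p ^ m) u\<close> and \<open>root_exp (p ^ m) 1\<close>.
  Both points are primitive roots of order \<open>p ^ m\<close>, hence conjugate.\<close>

lemma root_exp_sum_conjugate:
  fixes f :: "'a \<Rightarrow> int"
  assumes p: "prime p" "m > 0" and u: "coprime u (int p)"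
    and z: "(\<Sum>s\<in>S. root_exp (p ^ m) (u * f s)) = 0"
  shows "(\<Sum>s\<in>S. root_exp (p ^ m) (f s)) = 0"
proof -
  let ?n = "p ^ m"
  have n: "?n > 0" using p by (simp add: prime_gt_0_nat)
  obtain k where m: "m = Suc k" using p(2) gr0_implies_Suc by blast
  define P where "P = (\<Sum>s\<in>S. monom (1::int) (nat (f s mod int ?n)))"
  have P: "ipoly P (root_exp ?n v) = (\<Sum>s\<in>S. root_exp ?n (v * f s))" for v
  proof -
    have "root_exp ?n v ^ nat (f s mod int ?n) = root_exp ?n (v * f s)" for s
    proof -
      have "root_exp ?n v ^ nat (f s mod int ?n) = root_exp ?n (v * (f s mod int ?n))"
        using n by (simp flip: root_exp_mult_nat del: of_nat_power)
      also have "\<dots> = root_exp ?n (v * f s)"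
        by (rule root_exp_cong[OF n]) (simp only: cong_def mod_mult_right_eq)
      finally show ?thesis .
    qed
    then show ?thesis by (simp add: P_def ipoly_sum ipoly_monom)
  qed
  have "ipoly P (root_exp ?n u) = 0" using z by (simp add: P)
  then have "ipoly P (root_exp ?n 1) = 0"
    using conjugate_prime_power_roots[OF p(1) root_exp_primitive[OF p(1) u] root_exp_primitive[OF p(1), of 1 k], of P]
    by (simp add: m)
  then show ?thesis by (simp add: P)
qed

lemma sum_root_exp_multiples:
  assumes "n > 0"
  shows "(\<Sum>i\<in>{0..<int n}. root_exp n (i * t)) = (if int n dvd t then of_nat n else 0)"
proof -
  have "(\<Sum>i\<in>{0..<int n}. root_exp n (i * t)) = (\<Sum>i<n. root_exp n t ^ i)"
    by (rule sum.reindex_bij_witness[of _ int nat]) (auto simp: mult.commute simp flip: root_exp_mult_nat)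
  moreover have "root_exp n t ^ n = 1"
    using assms by (simp add: root_exp_eq_1_iff flip: root_exp_mult_nat)
  ultimately show ?thesis
    using assms by (cases "root_exp n t = 1") (simp_all add: geometric_sum root_exp_eq_1_iff)
qed

section \<open>Characters and spectra of the group of pairs of residues\<close>

definition dot :: "int \<times> int \<Rightarrow> int \<times> int \<Rightarrow> int"
  where "dot x s = fst x * fst s + snd x * snd s"

lemma mult_Z2: "x \<otimes>\<^bsub>Z2 n\<^esub> y = ((fst x + fst y) mod int n, (snd x + snd y) mod int n)"
  by (simp add: DirProd_def split: prod.splits)

text \<open>Trades \<open>pairing\<close> for \<open>dot\<close>, which is bilinear over the
  integers, so that differences \<open>a - b\<close> can be used without reducing them into the
  carrier.\<close>

lemma character_on_eq:
  assumes "n > 0" "x \<in> A"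
  shows "character_on n A s x = root_exp n (dot x s)"
proof -
  have "character_on n A s x = root_exp n (pairing n x s)"
    using assms by (simp add: character_on_def root_exp_def cis_conv_exp mult_ac)
  also have "\<dots> = root_exp n (dot x s)"
    by (rule root_exp_cong[OF assms(1)]) (simp add: pairing_def dot_def)
  finally show ?thesis .
qed

lemma sum_fun_apply: "(\<Sum>i\<in>I. f i) x = (\<Sum>i\<in>I. f i x)"
  by (induction I rule: infinite_finite_induct) auto

text \<open>Row orthogonality passes to columns: the point mass at \<open>b\<close> is expanded in
  the character basis and the expansion is evaluated at \<open>a\<close>.\<close>

lemma spectral_dual:
  assumes n: "n > 0" and sp: "spectral n A" and ne: "A \<noteq> {}"
  obtains S where "S \<subseteq> carrier (Z2 n)" "card S = card A"
    "\<And>a b. a \<in> A \<Longrightarrow> b \<in> A \<Longrightarrow> a \<noteq> b \<Longrightarrow> (\<Sum>s\<in>S. root_exp n (dot (a - b) s)) = 0"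
proof -
  interpret vector_space scale_fun by (rule vector_space_scale_fun)
  let ?e = "character_on n A"
  from sp obtain S where A: "A \<subseteq> carrier (Z2 n)" and S: "S \<subseteq> carrier (Z2 n)"
    and orth: "\<And>s t. s \<in> S \<Longrightarrow> t \<in> S \<Longrightarrow> s \<noteq> t \<Longrightarrow> inner_L2 A (?e s) (?e t) = 0"
    and inj: "inj_on ?e S" and span: "span (?e ` S) = L2 A"
    unfolding spectral_def orthogonal_basis_L2_def by blast
  have fin: "finite A" "finite S" using A S n by (auto simp: carrier_integer_mod_group intro: finite_subset)
  have norm: "inner_L2 A (?e s) (?e s) = of_nat (card A)" for s
    using n by (simp add: inner_L2_def character_on_eq root_exp_def flip: complex_norm_square)
  have main: "(\<Sum>s\<in>S. root_exp n (dot (a - b) s)) = (if a = b then of_nat (card A) else 0)"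
    if a: "a \<in> A" and b: "b \<in> A" for a b
  proof -
    define \<delta> where "\<delta> = (\<lambda>x. if x = b then 1 else 0 :: complex)"
    have "\<delta> \<in> span (?e ` S)" using b by (simp add: span L2_def \<delta>_def)
    then obtain u where "\<delta> = (\<Sum>v\<in>?e ` S. scale_fun (u v) v)"
      using fin(2) by (auto simp: span_finite)
    then have "\<delta> = (\<Sum>s\<in>S. scale_fun (u (?e s)) (?e s))"
      by (simp add: sum.reindex[OF inj])
    then have \<delta>: "\<delta> x = (\<Sum>s\<in>S. u (?e s) * ?e s x)" for x
      by (simp add: sum_fun_apply scale_fun_def)
    \<comment> \<open>The inner product of the expansion with the character of \<open>t\<close>
      isolates its coefficient; every character has squared norm \<open>card A\<close>.\<close>
    have c: "cnj (?e t b) = u (?e t) * of_nat (card A)" if t: "t \<in> S" for t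
    proof -
      have "cnj (?e t b) = (\<Sum>x\<in>A. \<delta> x * cnj (?e t x))"
        using fin b by (simp add: \<delta>_def if_distribR if_distrib[of "\<lambda>x. x * _"] sum.delta cong: if_cong)
      also have "\<dots> = (\<Sum>s\<in>S. u (?e s) * inner_L2 A (?e s) (?e t))"
        unfolding \<delta> inner_L2_def sum_distrib_left sum_distrib_right
        by (subst sum.swap) (simp add: mult.assoc)
      also have "\<dots> = (\<Sum>s\<in>S. if s = t then u (?e t) * of_nat (card A) else 0)"
        using t by (intro sum.cong) (auto simp: orth norm)
      finally show ?thesis using t fin by simp
    qed
    have "(\<Sum>s\<in>S. root_exp n (dot (a - b) s)) = (\<Sum>s\<in>S. ?e s a * cnj (?e s b))"
      using n a b
      by (intro sum.cong refl)
        (simp add: character_on_eq dot_def algebra_simps flip: root_exp_uminus root_exp_add)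
    also have "\<dots> = \<delta> a * of_nat (card A)"
      by (simp add: \<delta> c sum_distrib_left sum_distrib_right mult_ac)
    finally show ?thesis by (simp add: \<delta>_def)
  qed
  obtain a where "a \<in> A" using ne by blast
  \<comment> \<open>On the diagonal every summand is 1, so the sum counts \<open>S\<close>.\<close>
  from main[OF this this] have "of_nat (card S) = (of_nat (card A) :: complex)"
    by (simp add: dot_def)
  then have "card S = card A" by (simp only: of_nat_eq_iff)
  then show thesis using S main by (intro that[of S]) simp_all
qed

text \<open>If the sums vanished at every nonzero \<open>g\<close>, their total over the group would
  be \<open>card S\<close>. Summing over \<open>g\<close> first gives \<open>n\<^sup>2\<close> or 0,
  according to whether the origin lies in \<open>S\<close>. The bounds on \<open>card S\<close>
  exclude both.\<close>

lemma exists_nonvanishing_frequency: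
  assumes n: "n > 0" and S: "S \<subseteq> carrier (Z2 n)" "S \<noteq> {}" "card S < n\<^sup>2"
  obtains g where "g \<in> carrier (Z2 n)" "g \<noteq> (0, 0)" "(\<Sum>s\<in>S. root_exp n (dot g s)) \<noteq> 0"
proof (rule ccontr)
  note thesisI = that
  let ?G = "carrier (Z2 n)" and ?I = "{0..<int n}"
  assume "\<not> thesis"
  then have z: "(\<Sum>s\<in>S. root_exp n (dot g s)) = 0" if "g \<in> ?G" "g \<noteq> (0, 0)" for g
    using thesisI that by blast
  have fin: "finite S" "finite ?G" using S n by (auto simp: carrier_integer_mod_group intro: finite_subset)
  have "of_nat (card S) = (\<Sum>g\<in>?G. if g = (0, 0) then of_nat (card S) else 0 :: complex)"
    using fin n by (subst sum.delta) (auto simp: carrier_integer_mod_group)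
  also have "\<dots> = (\<Sum>g\<in>?G. \<Sum>s\<in>S. root_exp n (dot g s))"
    by (rule sum.cong[OF refl]) (simp add: z, simp add: dot_def)
  also have "\<dots> = (\<Sum>s\<in>S. \<Sum>g\<in>?G. root_exp n (dot g s))" by (rule sum.swap)
  also have "\<dots> = (\<Sum>s\<in>S. (\<Sum>i\<in>?I. root_exp n (i * fst s)) * (\<Sum>j\<in>?I. root_exp n (j * snd s)))"
    using n by (simp add: carrier_integer_mod_group dot_def root_exp_add sum_product
        sum.cartesian_product case_prod_unfold)
  also have "\<dots> = (\<Sum>s\<in>S. if s = (0, 0) then of_nat (n\<^sup>2) else 0)"
  proof (rule sum.cong[OF refl])
    fix s assume "s \<in> S"
    then have "s \<in> ?I \<times> ?I" using S n by (auto simp: carrier_integer_mod_group)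
    then have "int n dvd fst s \<longleftrightarrow> fst s = 0" "int n dvd snd s \<longleftrightarrow> snd s = 0"
      by (auto dest: zdvd_imp_le)
    then show "(\<Sum>i\<in>?I. root_exp n (i * fst s)) * (\<Sum>j\<in>?I. root_exp n (j * snd s))
        = (if s = (0, 0) then of_nat (n\<^sup>2) else 0)"
      using n by (auto simp: sum_root_exp_multiples power2_eq_square prod_eq_iff)
  qed
  also have "\<dots> = of_nat (if (0, 0) \<in> S then n\<^sup>2 else 0)" using fin by simp
  finally have "card S = (if (0, 0) \<in> S then n\<^sup>2 else 0)" by (simp only: of_nat_eq_iff)
  then show False using S fin by (auto split: if_splits)
qed

section \<open>Tiling by the first \<open>p\<close> multiples of a nonvanishing frequency\<close>

theorem lemma14:
  fixes p m :: nat and A :: "(int \<times> int) set"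
  assumes "prime p" and "m > 0"
    and "spectral (p ^ m) A"
    and "card A < p ^ (2 * m)" and "p ^ (2 * m - 1) \<le> card A"
  shows "tile (Z2 (p ^ m)) A \<and> card A = p ^ (2 * m - 1)"
proof -
  define n where "n = p ^ m"
  let ?G = "carrier (Z2 n)"
  have p0: "p > 0" using assms(1) by (simp add: prime_gt_0_nat)
  have n: "n > 0" using p0 by (simp add: n_def)
  have n2: "n\<^sup>2 = p ^ (2 * m)" by (simp add: n_def power_mult power2_eq_square mult.commute flip: power_add)
  have pm: "p ^ (2 * m) = p * p ^ (2 * m - 1)" using assms(2) by (simp flip: power_Suc)
  have sp: "spectral n A" using assms(3) by (simp add: n_def)
  have cA: "card A > 0" using assms(5) p0 by (metis gr0I le_zero_eq power_not_zero neq0_conv)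
  then have A0: "A \<noteq> {}" by auto
  have AG: "A \<subseteq> ?G" using sp by (simp add: spectral_def)
  have finG: "finite ?G" and cG: "card ?G = n\<^sup>2"
    using n by (simp_all add: carrier_integer_mod_group power2_eq_square)
  obtain S where S: "S \<subseteq> ?G" "card S = card A"
    and van: "\<And>a b. a \<in> A \<Longrightarrow> b \<in> A \<Longrightarrow> a \<noteq> b \<Longrightarrow> (\<Sum>s\<in>S. root_exp n (dot (a - b) s)) = 0"
    using spectral_dual[OF n sp A0] by blast
  have "S \<noteq> {}" "card S < n\<^sup>2" using S cA assms(4) n2 by auto
  then obtain g where g: "g \<in> ?G" "g \<noteq> (0, 0)" "(\<Sum>s\<in>S. root_exp n (dot g s)) \<noteq> 0"
    using exists_nonvanishing_frequency[OF n S(1)] by blast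
  \<comment> \<open>The multiple \<open>i g\<close>; those with \<open>0 \<le> i < p\<close> will
    form the tiling complement.\<close>
  define \<beta> where "\<beta> i = (i * fst g mod int n, i * snd g mod int n)" for i
  have core: "a = b \<and> i = j"
    if a: "a \<in> A" and b: "b \<in> A" and i: "i \<in> {0..<int p}" and j: "j \<in> {0..<int p}"
      and eq: "a \<otimes>\<^bsub>Z2 n\<^esub> \<beta> i = b \<otimes>\<^bsub>Z2 n\<^esub> \<beta> j" for a b i j
  proof -
    have c: "[fst a - fst b = (j - i) * fst g] (mod int n)"
      "[snd a - snd b = (j - i) * snd g] (mod int n)"
      using eq by (auto simp: mult_Z2 \<beta>_def mod_simps cong_iff_dvd_diff mod_eq_dvd_iff algebra_simps)
    have inI: "x \<in> ?G \<Longrightarrow> fst x \<in> {0..<int n} \<and> snd x \<in> {0..<int n}" for x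
      using n by (auto simp: carrier_integer_mod_group)
    have ij: "i = j"
    proof (rule ccontr)
      assume "i \<noteq> j"
      then have "\<not> int p dvd j - i"
        using i j dvd_imp_le_int[of "j - i" "int p"] by auto
      then have cop: "coprime (j - i) (int p)"
        using assms(1) by (metis coprime_commute prime_imp_coprime prime_nat_int_transfer)
      show False
      proof (cases "a = b")
        case True
        \<comment> \<open>Here \<open>(j - i) g\<close> is 0 modulo \<open>n\<close> and
          \<open>j - i\<close> is invertible, so \<open>g\<close> would be 0.\<close>
        have "coprime (int n) (j - i)" using cop by (simp add: n_def coprime_commute)
        moreover have "int n dvd (j - i) * fst g" "int n dvd (j - i) * snd g"
          using c True by (auto simp: cong_iff_dvd_diff dvd_minus_iff)
        ultimately have "int n dvd fst g" "int n dvd snd g"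
          by (simp_all add: coprime_dvd_mult_right_iff)
        then have "fst g = 0" "snd g = 0" using inI[OF g(1)] by (auto dest: zdvd_imp_le)
        then show False using g(2) by (simp add: prod_eq_iff)
      next
        case False
        \<comment> \<open>Here \<open>(j - i) g\<close> is congruent to the nonzero difference
          \<open>a - b\<close>, where the sum over \<open>S\<close> vanishes; conjugation carries
          this zero to \<open>g\<close>, against its choice.\<close>
        have "(\<Sum>s\<in>S. root_exp n ((j - i) * dot g s)) = (\<Sum>s\<in>S. root_exp n (dot (a - b) s))"
        proof (intro sum.cong refl root_exp_cong[OF n])
          fix s
          have "[(j - i) * fst g * fst s + (j - i) * snd g * snd s
              = (fst a - fst b) * fst s + (snd a - snd b) * snd s] (mod int n)"
            using c by (intro cong_add cong_mult cong_refl) (simp_all add: cong_sym)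
          then show "[(j - i) * dot g s = dot (a - b) s] (mod int n)"
            by (simp add: dot_def algebra_simps)
        qed
        also have "\<dots> = 0" using van[OF a b False] .
        finally show False
          using root_exp_sum_conjugate[OF assms(1,2) cop, of "dot g" S] g(3) by (simp add: n_def)
      qed
    qed
    then have "int n dvd fst a - fst b" "int n dvd snd a - snd b"
      using c by (simp_all add: cong_iff_dvd_diff)
    then have "fst a mod int n = fst b mod int n" "snd a mod int n = snd b mod int n"
      by (simp_all add: mod_eq_dvd_iff)
    moreover have "a \<in> ?G" "b \<in> ?G" using a b AG by blast+
    ultimately have "a = b" using inI[of a] inI[of b] by (simp add: prod_eq_iff)
    with ij show ?thesis by simp
  qed
  define F where "F = (\<lambda>(a, i). a \<otimes>\<^bsub>Z2 n\<^esub> \<beta> i)"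
  let ?D = "A \<times> {0..<int p}"
  have inj: "inj_on F ?D" using core by (fastforce simp: F_def inj_on_def)
  have FG: "F ` ?D \<subseteq> ?G" using n by (auto simp: F_def mult_Z2 carrier_integer_mod_group)
  have cF: "card (F ` ?D) = p * card A" by (simp add: card_image[OF inj] card_cartesian_product)
  \<comment> \<open>The disjoint translates fit into the group, which bounds \<open>card A\<close>
    from above. With the assumed lower bound this is an equality, so they exhaust the group.\<close>
  have "p * card A \<le> p * p ^ (2 * m - 1)"
    using card_mono[OF finG FG] cF cG n2 pm by simp
  then have card: "card A = p ^ (2 * m - 1)" using assms(5) p0 by simp
  have surj: "F ` ?D = ?G"
    using card_subset_eq[OF finG FG] cF cG n2 pm card by simp
  have "tile (Z2 n) A"
    unfolding tile_def
  proof (intro conjI AG exI[of _ "\<beta> ` {0..<int p}"] ballI)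
    show "\<beta> ` {0..<int p} \<subseteq> ?G" using n by (auto simp: \<beta>_def carrier_integer_mod_group)
    fix x assume "x \<in> ?G"
    then obtain a i where ai: "a \<in> A" "i \<in> {0..<int p}" "x = a \<otimes>\<^bsub>Z2 n\<^esub> \<beta> i"
      unfolding surj[symmetric] F_def by auto
    show "\<exists>!ab. ab \<in> A \<times> \<beta> ` {0..<int p} \<and> x = fst ab \<otimes>\<^bsub>Z2 n\<^esub> snd ab"
    proof (rule ex1I[of _ "(a, \<beta> i)"])
      fix ab assume "ab \<in> A \<times> \<beta> ` {0..<int p} \<and> x = fst ab \<otimes>\<^bsub>Z2 n\<^esub> snd ab"
      then obtain b j where bj: "ab = (b, \<beta> j)" "b \<in> A" "j \<in> {0..<int p}" "x = b \<otimes>\<^bsub>Z2 n\<^esub> \<beta> j"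
        by auto
      then show "ab = (a, \<beta> i)" using core[OF ai(1) bj(2) ai(2) bj(3)] ai(3) by simp
    qed (use ai in auto)
  qed
  with card show ?thesis by (simp add: n_def)
qed

end
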